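(* Let $n\ge 1$. Then: (i) $\mathrm{sPMET}_n=\{p\in\mathrm{PMET}_n: p^{+}\in\mathrm{PMET}_{n+1}\}$, where $\mathrm{PMET}_{n+1}$ is taken on the point set $\{0,1,\dots,n\}$. (ii) $\mathrm{sWMET}_n=\mathrm{MET}_{n+1}$ (under the identification $\iota$ below) and $P(\mathrm{MET}_{n+1})=\mathrm{sPMET}_n$. (iii) The $0,1$-valued elements of $\mathrm{sPMET}_n$ are the zero function and the $2^n-1$ partial $2$-cuts $\gamma(S;\overline S)$ with $\emptyset\ne S\subseteq V_n$; the latter generate $0,1\text{-}\mathrm{sPMET}_n$, and $0,1\text{-}\mathrm{sPMET}_n=P(\mathrm{CUT}_{n+1})$. Moreover $\{q: (q,w)\in Q(\mathrm{CUT}_{n+1})\text{ for some }w\}=\mathrm{OCUT}_n$.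
   Context: $V_n=\{1,\dots,n\}$. $\mathrm{PMET}_n$ is the cone of symmetric $p:V_n^2\to\mathbb{R}$ with $p_{ij}\ge0$, $p_{ik}+p_{kj}-p_{ij}-p_{kk}\ge0$ for all $i,j,k$, and $p_{ij}\ge p_{ii}$ for all $i\ne j$; $\mathrm{sPMET}_n$ is its subcone with additionally $p_{ii}+p_{jj}-p_{ij}\ge0$ for all $i,j$. For $p\in\mathrm{PMET}_n$ its lifting $p^+$ is the function on $\{0,1,\dots,n\}^2$ with $p^+_{00}=0$, $p^+_{0i}=p^+_{i0}=p_{ii}$ and $p^+_{ij}=p_{ij}$ for $i,j\in V_n$. $\mathrm{MET}_m$ is the cone of semimetrics (symmetric, zero diagonal, triangle inequality) on an $m$-set; $\mathrm{CUT}_{m}$ is the cone generated by the $2$-cuts $\delta(T)$ ($\delta(T)_{ij}=1$ iff exactly one of $i,j$ lies in $T$). $\mathrm{sWMET}_n$ is the cone of pairs $(d;w)$ with $d$ a semimetric on $V_n$, $w\in\mathbb{R}^n_{\ge0}$, and $w_i-w_j\le d_{ij}\le w_i+w_j$ for all distinct $i,j$. The identification $\iota$: a semimetric $d'$ on $\{0,1,\dots,n\}$ corresponds to $(d;w)$ with $d_{ij}=d'_{ij}$ ($i,j\in V_n$) and $w_i=d'_{0i}$. $P(d;w)$ is the symmetric $p$ with $p_{ij}=\frac{d_{ij}+w_i+w_j}2$; $Q(d;w)=(q,w)$ with $q_{ij}=\frac{d_{ij}-w_i+w_j}2$; $P,Q$ are applied to semimetrics on $\{0,\dots,n\}$ via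 $\iota$. For $S\subseteq V_n$ with complement $\overline S$, the partial $2$-cut $\gamma(S;\overline S)$ is the symmetric $0,1$-function with $\gamma_{ij}=1$ iff $\{i,j\}\cap S\ne\emptyset$ (diagonal included). For a cone $C$, $0,1\text{-}C$ is the cone generated by all extreme rays of $C$ containing a nonzero $0,1$-valued point. For an ordered pair $(S,\overline S)$, the o-cut $\delta'(S)$ is the function on $V_n^2$ with $\delta'(S)_{ij}=1$ if $i\in S$, $j\notin S$ and $0$ otherwise; $\mathrm{OCUT}_n$ is the cone generated by all o-cuts. *)

theory Defs
  imports "HOL-Analysis.Analysis" "HOL-Library.Function_Algebras"
begin

text \<open>
  The pointwise vector space structure on functions, so that the library notions
  \<^const>\<open>convex_cone\<close> and \<^const>\<open>face_of\<close>
  apply to cones of functions.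
\<close>

instantiation "fun" :: (type, real_vector) real_vector
begin

definition "c *\<^sub>R f = (\<lambda>x. c *\<^sub>R f x)"

instance
  by standard (simp_all add: scaleR_fun_def fun_eq_iff scaleR_add_right scaleR_add_left)

end

lemma scaleR_fun_apply [simp]: "(c *\<^sub>R f) x = c *\<^sub>R f x"
  by (simp add: scaleR_fun_def)

type_synonym vec1 = "nat \<Rightarrow> real"
type_synonym vec2 = "nat \<Rightarrow> nat \<Rightarrow> real"

abbreviation V :: "nat \<Rightarrow> nat set" where
  "V n \<equiv> {1..n}"

text \<open>
  A real function on \<open>A\<close> (on \<open>A \<times> A\<close>) is represented by the unique total function that
  agrees with it there and is 0 elsewhere; this is what the guards in the definitions below are
  for.
\<close>

definition fun_on :: "nat set \<Rightarrow> vec1 set" where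
  "fun_on A = {w. \<forall>i. i \<notin> A \<longrightarrow> w i = 0}"

definition fun_on2 :: "nat set \<Rightarrow> vec2 set" where
  "fun_on2 A = {p. \<forall>i j. i \<notin> A \<or> j \<notin> A \<longrightarrow> p i j = 0}"

definition sym_on2 :: "nat set \<Rightarrow> vec2 set" where
  "sym_on2 A = {p \<in> fun_on2 A. \<forall>i\<in>A. \<forall>j\<in>A. p i j = p j i}"

definition PMET :: "nat set \<Rightarrow> vec2 set" where
  "PMET A = {p \<in> sym_on2 A.
     (\<forall>i\<in>A. \<forall>j\<in>A. 0 \<le> p i j) \<and>
     (\<forall>i\<in>A. \<forall>j\<in>A. \<forall>k\<in>A. 0 \<le> p i k + p k j - p i j - p k k) \<and>
     (\<forall>i\<in>A. \<forall>j\<in>A. i \<noteq> j \<longrightarrow> p i i \<le> p i j)}"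

definition sPMET :: "nat set \<Rightarrow> vec2 set" where
  "sPMET A = {p \<in> PMET A. \<forall>i\<in>A. \<forall>j\<in>A. 0 \<le> p i i + p j j - p i j}"

text \<open>The lifting; the point 0 is the new one, \<open>p\<close> lives on a set of positive numbers.\<close>

definition lifting :: "vec2 \<Rightarrow> vec2" where
  "lifting p = (\<lambda>i j.
     if i = 0 \<and> j = 0 then 0 else if i = 0 then p j j else if j = 0 then p i i else p i j)"

definition MET :: "nat set \<Rightarrow> vec2 set" where
  "MET A = {d \<in> sym_on2 A.
     (\<forall>i\<in>A. d i i = 0) \<and>
     (\<forall>i\<in>A. \<forall>j\<in>A. \<forall>k\<in>A. d i j \<le> d i k + d k j)}"

definition two_cut :: "nat set \<Rightarrow> nat set \<Rightarrow> vec2" where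
  "two_cut A T = (\<lambda>i j. if i \<in> A \<and> j \<in> A \<and> (i \<in> T \<longleftrightarrow> j \<notin> T) then 1 else 0)"

definition CUT :: "nat set \<Rightarrow> vec2 set" where
  "CUT A = convex_cone hull {two_cut A T |T. T \<subseteq> A}"

definition sWMET :: "nat \<Rightarrow> (vec2 \<times> vec1) set" where
  "sWMET n = {(d, w). d \<in> MET (V n) \<and> w \<in> fun_on (V n) \<and> (\<forall>i\<in>V n. 0 \<le> w i) \<and>
     (\<forall>i\<in>V n. \<forall>j\<in>V n. i \<noteq> j \<longrightarrow> w i - w j \<le> d i j \<and> d i j \<le> w i + w j)}"

definition iota :: "nat \<Rightarrow> vec2 \<Rightarrow> vec2 \<times> vec1" where
  "iota n d' =
     ((\<lambda>i j. if i \<in> V n \<and> j \<in> V n then d' i j else 0),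
      (\<lambda>i. if i \<in> V n then d' 0 i else 0))"

definition P :: "nat \<Rightarrow> vec2 \<times> vec1 \<Rightarrow> vec2" where
  "P n = (\<lambda>(d, w) i j. if i \<in> V n \<and> j \<in> V n then (d i j + w i + w j) / 2 else 0)"

definition Q :: "nat \<Rightarrow> vec2 \<times> vec1 \<Rightarrow> vec2 \<times> vec1" where
  "Q n = (\<lambda>(d, w).
     ((\<lambda>i j. if i \<in> V n \<and> j \<in> V n then (d i j - w i + w j) / 2 else 0), w))"

definition partial_two_cut :: "nat \<Rightarrow> nat set \<Rightarrow> vec2" where
  "partial_two_cut n S =
     (\<lambda>i j. if i \<in> V n \<and> j \<in> V n \<and> {i, j} \<inter> S \<noteq> {} then 1 else 0)"

definition o_cut :: "nat \<Rightarrow> nat set \<Rightarrow> vec2" where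
  "o_cut n S = (\<lambda>i j. if i \<in> V n \<and> j \<in> V n \<and> i \<in> S \<and> j \<notin> S then 1 else 0)"

definition OCUT :: "nat \<Rightarrow> vec2 set" where
  "OCUT n = convex_cone hull {o_cut n S |S. S \<subseteq> V n}"

definition zero_one_valued :: "vec2 \<Rightarrow> bool" where
  "zero_one_valued p \<longleftrightarrow> (\<forall>i j. p i j = 0 \<or> p i j = 1)"

definition extreme_ray_of :: "'a::real_vector set \<Rightarrow> 'a set \<Rightarrow> bool" (infix "extreme'_ray'_of" 50)
  where "R extreme_ray_of C \<longleftrightarrow> R face_of C \<and> (\<exists>v. v \<noteq> 0 \<and> R = {t *\<^sub>R v |t. 0 \<le> t})"

definition zero_one_cone :: "vec2 set \<Rightarrow> vec2 set" where
  "zero_one_cone C = convex_cone hull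
     \<Union>{R. R extreme_ray_of C \<and> (\<exists>p\<in>R. p \<noteq> 0 \<and> zero_one_valued p)}"

end

theory Submission
  imports Defs
begin

text \<open>
  Writing \<open>d i j = 2 p i j - p i i - p j j\<close> and \<open>w i = p i i\<close> inverts \<open>P\<close> and translates the
  inequalities of \<open>sPMET\<close> into those of \<open>sWMET\<close>; the weights are the distances to the point 0.
  The inequalities defining \<open>sPMET\<close> that are tight at a partial 2-cut \<open>\<gamma>\<close> have only the multiples of
  \<open>\<gamma>\<close> as common solutions, so every partial 2-cut spans an extreme ray. The statements on cones
  of cuts follow since linear maps commute with the generation of convex cones.
\<close>

section \<open>Convex cone hulls and linear maps\<close>

lemma convex_cone_hull_linear_image:
  assumes "linear f"
  shows "convex_cone hull (f ` S) = f ` (convex_cone hull S)"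
proof
  show "convex_cone hull (f ` S) \<subseteq> f ` (convex_cone hull S)"
    by (intro hull_minimal image_mono hull_subset)
       (simp add: convex_cone_linear_image convex_cone_convex_cone_hull assms)
  \<comment> \<open>The preimage of a convex cone under a linear map is a convex cone; this one
    contains \<open>S\<close>, hence also the hull of \<open>S\<close>.\<close>
  have "convex_cone {x. f x \<in> convex_cone hull (f ` S)}"
    using assms
    by (auto simp: convex_cone_iff linear_0 linear_add linear_scale convex_cone_hull_contains_0
        convex_cone_hull_add convex_cone_hull_mul)
  then have "convex_cone hull S \<subseteq> {x. f x \<in> convex_cone hull (f ` S)}"
    by (intro hull_minimal) (auto intro: hull_inc)
  then show "f ` (convex_cone hull S) \<subseteq> convex_cone hull (f ` S)"
    by blast
qed

text \<open>Serves to drop the zero function, the image under \<open>P\<close> of the two trivial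
  cuts, from a generating set.\<close>

lemma convex_cone_hull_insert_0: "convex_cone hull (insert 0 S) = convex_cone hull S"
  by (rule hull_redundant) (rule convex_cone_hull_contains_0)

section \<open>Working forms of the defining inequalities\<close>

lemma atLeast0_atMost_iff_V: "i \<in> {0..n} \<longleftrightarrow> i = 0 \<or> i \<in> V n"
  by auto

text \<open>Going from \<open>i\<close> to \<open>j\<close> and back is a degenerate triangle: by
  symmetry, \<open>0 = d i i\<close> is at most twice \<open>d i j\<close>.\<close>

lemma MET_nonneg:
  assumes "d \<in> MET A" "i \<in> A" "j \<in> A"
  shows "0 \<le> d i j"
proof -
  have "d i i \<le> d i j + d j i" "d i i = 0" "d i j = d j i"
    using assms unfolding MET_def sym_on2_def by blast+
  then show ?thesis by linarith
qed

text \<open>A form without subtraction, grouped by the number of points involved. The guard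
  \<open>i \<noteq> j\<close> can go because its inequality is trivial for
  \<open>i = j\<close>.\<close>

lemma PMET_iff:
  "p \<in> PMET A \<longleftrightarrow>
     (\<forall>i j. i \<notin> A \<or> j \<notin> A \<longrightarrow> p i j = 0) \<and>
     (\<forall>i\<in>A. \<forall>j\<in>A. p i j = p j i \<and> 0 \<le> p i j \<and> p i i \<le> p i j) \<and>
     (\<forall>i\<in>A. \<forall>j\<in>A. \<forall>k\<in>A. p i j + p k k \<le> p i k + p k j)"
proof -
  have "p i i \<le> p i j \<longleftrightarrow> (i \<noteq> j \<longrightarrow> p i i \<le> p i j)" for i j
    by auto
  moreover have "0 \<le> p i k + p k j - p i j - p k k \<longleftrightarrow> p i j + p k k \<le> p i k + p k j" for i j k
    by auto
  ultimately show ?thesis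
    unfolding PMET_def sym_on2_def fun_on2_def mem_Collect_eq by (simp only:) blast
qed

lemma sPMET_iff:
  "p \<in> sPMET A \<longleftrightarrow>
     (\<forall>i j. i \<notin> A \<or> j \<notin> A \<longrightarrow> p i j = 0) \<and>
     (\<forall>i\<in>A. \<forall>j\<in>A. p i j = p j i \<and> 0 \<le> p i j \<and> p i i \<le> p i j \<and> p i j \<le> p i i + p j j) \<and>
     (\<forall>i\<in>A. \<forall>j\<in>A. \<forall>k\<in>A. p i j + p k k \<le> p i k + p k j)"
proof -
  have "0 \<le> p i i + p j j - p i j \<longleftrightarrow> p i j \<le> p i i + p j j" for i j
    by auto
  then show ?thesis
    unfolding sPMET_def PMET_iff mem_Collect_eq by (simp only:) blast
qed

section \<open>Strong partial semimetrics and the lifting\<close>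

text \<open>For \<open>k = 0\<close> the triangle inequality of \<open>lifting p\<close> is exactly
  \<open>p i j \<le> p i i + p j j\<close>. With \<open>i = 0\<close> or \<open>j = 0\<close> it
  only says that a diagonal entry is at most another entry of its row, or that a diagonal entry is
  nonnegative.\<close>

lemma sPMET_eq_lifting:
  assumes A: "0 \<notin> A"
  shows "sPMET A = {p \<in> PMET A. lifting p \<in> PMET (insert 0 A)}"
proof (intro equalityI subsetI)
  fix p assume "p \<in> {p \<in> PMET A. lifting p \<in> PMET (insert 0 A)}"
  then have p: "p \<in> PMET A" and l: "lifting p \<in> PMET (insert 0 A)" by auto
  have "0 \<le> p i i + p j j - p i j" if "i \<in> A" "j \<in> A" for i j
  proof -
    have "lifting p i j + lifting p 0 0 \<le> lifting p i 0 + lifting p 0 j"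
      using l that unfolding PMET_iff by blast
    moreover have "i \<noteq> 0" "j \<noteq> 0" using that A by metis+
    ultimately show ?thesis by (simp add: lifting_def)
  qed
  then show "p \<in> sPMET A" using p unfolding sPMET_def by blast
next
  fix p assume p: "p \<in> sPMET A"
  then have pm: "p \<in> PMET A" unfolding sPMET_def by blast
  have z: "p i j = 0" if "i \<notin> A \<or> j \<notin> A" for i j
    using p that unfolding sPMET_iff by blast
  have s: "p i j = p j i" "0 \<le> p i j" "p i i \<le> p i j" "p i j \<le> p i i + p j j"
    if "i \<in> A" "j \<in> A" for i j
    using p that unfolding sPMET_iff by blast+
  have t: "p i j + p k k \<le> p i k + p k j" if "i \<in> A" "j \<in> A" "k \<in> A" for i j k
    using p that unfolding sPMET_iff by blast
  have ne: "i \<noteq> 0" if "i \<in> A" for i using that A by metis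
  have l: "lifting p 0 0 = 0"
    "\<And>i. i \<in> A \<Longrightarrow> lifting p 0 i = p i i" "\<And>i. i \<in> A \<Longrightarrow> lifting p i 0 = p i i"
    "\<And>i j. i \<in> A \<Longrightarrow> j \<in> A \<Longrightarrow> lifting p i j = p i j"
    by (auto simp: lifting_def dest: ne)
  have "lifting p \<in> PMET (insert 0 A)"
    unfolding PMET_iff
  proof (intro conjI allI impI ballI)
    \<comment> \<open>If one index is 0 and the other lies outside, \<open>lifting p\<close> reads a
      diagonal entry of \<open>p\<close> off \<open>A\<close>, which is 0 by
      \<open>z\<close>.\<close>
    fix i j assume "i \<notin> insert 0 A \<or> j \<notin> insert 0 A"
    then show "lifting p i j = 0"
      by (auto simp: lifting_def z)
  next
    fix i j assume "i \<in> insert 0 A" "j \<in> insert 0 A"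
    then show "lifting p i j = lifting p j i" "0 \<le> lifting p i j"
        "lifting p i i \<le> lifting p i j"
      by (elim insertE; simp add: l s)+
  next
    fix i j k assume "i \<in> insert 0 A" "j \<in> insert 0 A" "k \<in> insert 0 A"
    moreover have "p k j = p j k" if "j \<in> A" "k \<in> A"
      using s(1) that by blast
    \<comment> \<open>Eight cases, according to which of the three points are 0.\<close>
    ultimately show "lifting p i j + lifting p k k \<le> lifting p i k + lifting p k j"
      using s(2-4)[of i j] s(2-4)[of i k] s(2-4)[of j k] s(2-4)[of k j] s(2-4)[of k i]
        s(2)[of k k] t[of i j k] s(1)[of i k]
      by (elim insertE; simp add: l A)
  qed
  then show "p \<in> {p \<in> PMET A. lifting p \<in> PMET (insert 0 A)}" using pm by blast
qed

section \<open>Weighted semimetrics as semimetrics with an extra point\<close>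

lemma iota_mem_sWMET:
  assumes d: "d \<in> MET {0..n}"
  shows "iota n d \<in> sWMET n"
proof -
  have s: "d i j = d j i" if "i \<in> {0..n}" "j \<in> {0..n}" for i j
    using d that unfolding MET_def sym_on2_def by blast
  have t: "d i j \<le> d i k + d k j" if "i \<in> {0..n}" "j \<in> {0..n}" "k \<in> {0..n}" for i j k
    using d that unfolding MET_def by blast
  have z: "d i i = 0" if "i \<in> {0..n}" for i
    using d that unfolding MET_def by blast
  \<comment> \<open>Both bounds on the weights are triangle inequalities on the points 0,
    \<open>i\<close>, \<open>j\<close>.\<close>
  have w: "d 0 i - d 0 j \<le> d i j \<and> d i j \<le> d 0 i + d 0 j" if "i \<in> V n" "j \<in> V n" for i j
    using that t[of 0 i j] t[of i j 0] s[of j i] s[of i 0] by auto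
  show ?thesis
    unfolding iota_def sWMET_def MET_def sym_on2_def fun_on2_def fun_on_def
    using w by (auto intro: s z MET_nonneg[OF d] simp: t)
qed

text \<open>A point 0 is adjoined at distance \<open>w i\<close> from each \<open>i\<close>; the
  bounds relating \<open>w\<close> and \<open>d\<close> are precisely the triangle inequalities
  through this new point.\<close>

lemma sWMET_mem_iota_image:
  assumes "(d, w) \<in> sWMET n"
  obtains d' where "d' \<in> MET {0..n}" "iota n d' = (d, w)"
proof
  have d0: "d i j = 0" if "i \<notin> V n \<or> j \<notin> V n" for i j
    using assms that unfolding sWMET_def MET_def sym_on2_def fun_on2_def by blast
  have w0: "w i = 0" if "i \<notin> V n" for i
    using assms that unfolding sWMET_def fun_on_def by blast
  have m: "d \<in> MET (V n)" using assms unfolding sWMET_def by blast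
  have s: "d i j = d j i" for i j
    using m d0[of i j] d0[of j i] unfolding MET_def sym_on2_def by force
  have t: "d i j \<le> d i k + d k j" if "i \<in> V n" "j \<in> V n" "k \<in> V n" for i j k
    using m that unfolding MET_def by blast
  have z: "d i i = 0" for i
    using m d0[of i i] unfolding MET_def by blast
  have wn: "0 \<le> w i" for i
    using assms w0[of i] unfolding sWMET_def by (cases "i \<in> V n") auto
  \<comment> \<open>The definition bounds only distinct points; for \<open>i = j\<close> the bounds
    follow from the zero diagonal and \<open>0 \<le> w i\<close>.\<close>
  have w: "w i \<le> w j + d i j" "d i j \<le> w i + w j" if "i \<in> V n" "j \<in> V n" for i j
  proof -
    have "i \<noteq> j \<Longrightarrow> w i - w j \<le> d i j \<and> d i j \<le> w i + w j"
      using assms that unfolding sWMET_def by blast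
    then show "w i \<le> w j + d i j" "d i j \<le> w i + w j"
      using z[of i] wn[of i] by (cases "i = j"; force)+
  qed
  \<comment> \<open>No guards are required here: \<open>w\<close> and \<open>d\<close> already
    vanish off \<open>V n\<close>, and the entry at (0,0) is \<open>w 0 = 0\<close>.\<close>
  define d' where "d' = (\<lambda>i j. if i = 0 then w j else if j = 0 then w i else d i j)"
  have d': "d' 0 i = w i" "d' i 0 = w i" "i \<in> V n \<Longrightarrow> j \<in> V n \<Longrightarrow> d' i j = d i j" for i j
    by (auto simp: d'_def w0)
  have w00: "w 0 = 0" by (simp add: w0)
  show "d' \<in> MET {0..n}"
    unfolding MET_def sym_on2_def fun_on2_def mem_Collect_eq
  proof (intro conjI allI impI ballI)
    fix i j assume "i \<notin> {0..n} \<or> j \<notin> {0..n}"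
    then show "d' i j = 0" by (auto simp: d'_def w0 d0)
  next
    fix i j show "d' i j = d' j i" by (simp add: d'_def s)
  next
    fix i show "d' i i = 0" by (simp add: d'_def z w00)
  next
    fix i j k assume "i \<in> {0..n}" "j \<in> {0..n}" "k \<in> {0..n}"
    then show "d' i j \<le> d' i k + d' k j"
      \<comment> \<open>One fact per case: \<open>w(2)\<close> for \<open>k = 0\<close>,
        \<open>w(1)\<close> for exactly one endpoint 0, \<open>wn\<close> for both endpoints 0, and
        \<open>t\<close> when no point is 0.\<close>
      using w00 wn[of k] w(2)[of i j] w(1)[of i k] w(1)[of j k, unfolded s[of j k]] t[of i j k]
      unfolding atLeast0_atMost_iff_V by (elim disjE; simp add: d' del: atLeastAtMost_iff)
  qed
  show "iota n d' = (d, w)"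
    unfolding iota_def by (auto simp: fun_eq_iff d' d0 w0)
qed

text \<open>The values that \<open>iota\<close> discards are recovered from symmetry (the column of
  0), the zero diagonal (the entry at (0,0)) and the default value 0 off the point set.\<close>

lemma inj_on_iota: "inj_on (iota n) (MET {0..n})"
proof (rule inj_onI)
  fix d e assume d: "d \<in> MET {0..n}" and e: "e \<in> MET {0..n}" and eq: "iota n d = iota n e"
  have V: "d i j = e i j" if "i \<in> V n" "j \<in> V n" for i j
    using eq that unfolding iota_def by (auto simp: fun_eq_iff) metis
  have 0: "d 0 i = e 0 i" if "i \<in> V n" for i
    using eq that unfolding iota_def by (auto simp: fun_eq_iff) metis
  have s: "d i 0 = d 0 i" "e i 0 = e 0 i" if "i \<in> V n" for i
    using d e that unfolding MET_def sym_on2_def by auto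
  have z: "d i j = 0 \<and> e i j = 0" if "i \<notin> {0..n} \<or> j \<notin> {0..n}" for i j
    using d e that unfolding MET_def sym_on2_def fun_on2_def by blast
  have "d 0 0 = 0" "e 0 0 = 0"
    using d e unfolding MET_def by auto
  then show "d = e"
    using V 0 s z by (metis atLeast0_atMost_iff_V ext)
qed

lemma bij_betw_iota: "bij_betw (iota n) (MET {0..n}) (sWMET n)"
  unfolding bij_betw_def
proof (intro conjI inj_on_iota equalityI subsetI)
  fix x assume "x \<in> sWMET n"
  then show "x \<in> iota n ` MET {0..n}"
    by (cases x) (metis imageI sWMET_mem_iota_image)
qed (auto intro: iota_mem_sWMET)

section \<open>The image of the weighted semimetrics under P\<close>

text \<open>Since \<open>p i i = w i\<close>, the dictionary is:
  \<open>w i - w j \<le> d i j\<close> is \<open>p i i \<le> p i j\<close>,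
  \<open>d i j \<le> w i + w j\<close> is \<open>p i j \<le> p i i + p j j\<close>, and triangle
  inequalities correspond to each other.\<close>

lemma P_image_sWMET: "P n ` sWMET n = sPMET (V n)"
proof (intro equalityI subsetI)
  fix p assume "p \<in> P n ` sWMET n"
  then obtain d w where dw: "(d, w) \<in> sWMET n" and p: "p = P n (d, w)" by auto
  have m: "d \<in> MET (V n)" using dw unfolding sWMET_def by blast
  have s: "d i j = d j i" if "i \<in> V n" "j \<in> V n" for i j
    using m that unfolding MET_def sym_on2_def by force
  have t: "d i j \<le> d i k + d k j" if "i \<in> V n" "j \<in> V n" "k \<in> V n" for i j k
    using m that unfolding MET_def by blast
  have z: "d i i = 0" if "i \<in> V n" for i
    using m that unfolding MET_def by blast
  have wn: "0 \<le> w i" if "i \<in> V n" for i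
    using dw that unfolding sWMET_def by blast
  have w: "w i \<le> w j + d i j" "d i j \<le> w i + w j" if "i \<in> V n" "j \<in> V n" for i j
  proof -
    have "i \<noteq> j \<Longrightarrow> w i - w j \<le> d i j \<and> d i j \<le> w i + w j"
      using dw that unfolding sWMET_def by blast
    then show "w i \<le> w j + d i j" "d i j \<le> w i + w j"
      using z[of i] wn[of i] that by (cases "i = j"; force)+
  qed
  have pV: "p i j = (d i j + w i + w j) / 2" if "i \<in> V n" "j \<in> V n" for i j
    using that unfolding p P_def by simp
  show "p \<in> sPMET (V n)"
    unfolding sPMET_iff
  proof (intro conjI allI impI ballI)
    fix i j assume "i \<notin> V n \<or> j \<notin> V n"
    then show "p i j = 0" unfolding p P_def by auto
  next
    fix i j assume ij: "i \<in> V n" "j \<in> V n"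
    note h = pV[OF ij] pV[OF ij(2,1)] pV[OF ij(1,1)] pV[OF ij(2,2)] s[OF ij] z[OF ij(1)]
      z[OF ij(2)] w[OF ij] wn[OF ij(1)] wn[OF ij(2)] MET_nonneg[OF m ij]
    show "p i j = p j i" using h by argo
    show "0 \<le> p i j" using h by argo
    show "p i i \<le> p i j" using h by argo
    show "p i j \<le> p i i + p j j" using h by argo
  next
    fix i j k assume ijk: "i \<in> V n" "j \<in> V n" "k \<in> V n"
    \<comment> \<open>On both sides the weights contribute \<open>(w i + w j) / 2 + w k\<close> and
      cancel.\<close>
    show "p i j + p k k \<le> p i k + p k j"
      using ijk t[OF ijk] z[of k] by (simp only: pV) argo
  qed
next
  fix p assume p: "p \<in> sPMET (V n)"
  have z: "p i j = 0" if "i \<notin> V n \<or> j \<notin> V n" for i j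
    using p that unfolding sPMET_iff by blast
  have s: "p i j = p j i" "0 \<le> p i j" "p i i \<le> p i j" "p i j \<le> p i i + p j j"
    if "i \<in> V n" "j \<in> V n" for i j
    using p that unfolding sPMET_iff by blast+
  have t: "p i j + p k k \<le> p i k + p k j" if "i \<in> V n" "j \<in> V n" "k \<in> V n" for i j k
    using p that unfolding sPMET_iff by blast
  define w where "w = (\<lambda>i. p i i)"
  define d where "d = (\<lambda>i j. if i \<in> V n \<and> j \<in> V n then 2 * p i j - p i i - p j j else 0)"
  have dV: "d i j = 2 * p i j - p i i - p j j" if "i \<in> V n" "j \<in> V n" for i j
    using that by (simp add: d_def)
  have "d \<in> MET (V n)"
    unfolding MET_def sym_on2_def fun_on2_def mem_Collect_eq
  proof (intro conjI allI impI ballI)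
    fix i j assume "i \<notin> V n \<or> j \<notin> V n"
    then show "d i j = 0" by (auto simp: d_def)
  next
    fix i j assume "i \<in> V n" "j \<in> V n"
    then show "d i j = d j i" using s(1)[of i j] by (simp add: dV del: atLeastAtMost_iff)
  next
    fix i assume "i \<in> V n"
    then show "d i i = 0" by (simp add: dV del: atLeastAtMost_iff)
  next
    fix i j k assume "i \<in> V n" "j \<in> V n" "k \<in> V n"
    then show "d i j \<le> d i k + d k j"
      using t[of i j k] by (simp add: dV del: atLeastAtMost_iff)
  qed
  moreover have "w \<in> fun_on (V n)"
    by (auto simp: fun_on_def w_def z)
  moreover have "0 \<le> w i" if "i \<in> V n" for i
    using s(2)[of i i] that by (simp add: w_def)
  moreover have "w i - w j \<le> d i j \<and> d i j \<le> w i + w j" if "i \<in> V n" "j \<in> V n" for i j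
    unfolding dV[OF that] w_def using s[OF that] by argo
  ultimately have "(d, w) \<in> sWMET n"
    unfolding sWMET_def by blast
  moreover have "p = P n (d, w)"
    by (auto simp: P_def fun_eq_iff d_def w_def z)
  ultimately show "p \<in> P n ` sWMET n" by blast
qed

section \<open>The 0,1-valued strong partial semimetrics\<close>

lemma partial_two_cut_mem_sPMET: "partial_two_cut n S \<in> sPMET (V n)"
  unfolding sPMET_iff partial_two_cut_def by auto

lemma zero_one_valued_partial_two_cut: "zero_one_valued (partial_two_cut n S)"
  unfolding zero_one_valued_def partial_two_cut_def by auto

text \<open>The diagonal of a partial 2-cut is the indicator of \<open>S\<close>. Recovering
  \<open>S\<close> from it gives the test for being zero and the injectivity behind the
  count.\<close>

lemma partial_two_cut_diag:
  assumes "S \<subseteq> V n"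
  shows "{i. partial_two_cut n S i i \<noteq> 0} = S"
  using assms unfolding partial_two_cut_def by auto

lemma partial_two_cut_eq_0_iff:
  assumes "S \<subseteq> V n"
  shows "partial_two_cut n S = 0 \<longleftrightarrow> S = {}"
proof
  assume "partial_two_cut n S = 0"
  then show "S = {}" using partial_two_cut_diag[OF assms] by simp
next
  assume "S = {}"
  then show "partial_two_cut n S = 0" by (auto simp: partial_two_cut_def fun_eq_iff)
qed

text \<open>The set is read off the diagonal. As \<open>p i j\<close> lies above
  \<open>p i i\<close> and \<open>p j j\<close> and below their sum, a 0,1-valued
  \<open>p i j\<close> must be their maximum.\<close>

lemma zero_one_valued_sPMET:
  assumes p: "p \<in> sPMET (V n)" "zero_one_valued p"
  obtains S where "S \<subseteq> V n" "p = partial_two_cut n S"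
proof
  let ?S = "{i. p i i = 1}"
  have z: "p i j = 0" if "i \<notin> V n \<or> j \<notin> V n" for i j
    using p that unfolding sPMET_iff by blast
  have s: "p i j = p j i" "0 \<le> p i j" "p i i \<le> p i j" "p j j \<le> p i j" "p i j \<le> p i i + p j j"
    if "i \<in> V n" "j \<in> V n" for i j
    using p that unfolding sPMET_iff by metis+
  have zo: "p i j = 0 \<or> p i j = 1" for i j
    using p(2) unfolding zero_one_valued_def by blast
  show "?S \<subseteq> V n" using z by (metis (mono_tags) mem_Collect_eq subsetI zero_neq_one)
  have pV: "p i j = (if i \<in> ?S \<or> j \<in> ?S then 1 else 0)" if "i \<in> V n" "j \<in> V n" for i j
    using s[OF that] zo[of i i] zo[of i j] zo[of j j] by auto
  show "p = partial_two_cut n ?S"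
  proof (intro ext)
    fix i j show "p i j = partial_two_cut n ?S i j"
      using pV[of i j] z[of i j] by (cases "i \<in> V n \<and> j \<in> V n") (auto simp: partial_two_cut_def)
  qed
qed

lemma zero_one_valued_sPMET_eq:
  "{p \<in> sPMET (V n). zero_one_valued p} =
     insert 0 {partial_two_cut n S |S. S \<noteq> {} \<and> S \<subseteq> V n}"
proof (intro equalityI subsetI)
  fix p assume "p \<in> {p \<in> sPMET (V n). zero_one_valued p}"
  then obtain S where "S \<subseteq> V n" "p = partial_two_cut n S"
    using zero_one_valued_sPMET by blast
  then show "p \<in> insert 0 {partial_two_cut n S |S. S \<noteq> {} \<and> S \<subseteq> V n}"
    using partial_two_cut_eq_0_iff by blast
next
  fix p assume "p \<in> insert 0 {partial_two_cut n S |S. S \<noteq> {} \<and> S \<subseteq> V n}"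
  then obtain S where "p = partial_two_cut n S"
    using partial_two_cut_eq_0_iff[of "{}" n] by auto
  then show "p \<in> {p \<in> sPMET (V n). zero_one_valued p}"
    using partial_two_cut_mem_sPMET zero_one_valued_partial_two_cut by blast
qed

lemma card_partial_two_cuts:
  "card {partial_two_cut n S |S. S \<noteq> {} \<and> S \<subseteq> V n} = 2 ^ n - 1"
proof -
  have "{partial_two_cut n S |S. S \<noteq> {} \<and> S \<subseteq> V n} = partial_two_cut n ` (Pow (V n) - {{}})"
    by blast
  moreover have "inj_on (partial_two_cut n) (Pow (V n) - {{}})"
    by (rule inj_onI) (metis DiffD1 PowD partial_two_cut_diag)
  ultimately have "card {partial_two_cut n S |S. S \<noteq> {} \<and> S \<subseteq> V n} = card (Pow (V n) - {{}})"
    by (simp add: card_image)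
  also have "\<dots> = 2 ^ n - 1"
    by (simp add: card_Diff_singleton card_Pow)
  finally show ?thesis .
qed

section \<open>Extreme rays spanned by partial 2-cuts\<close>

lemma partial_two_cut_extreme_ray:
  assumes S: "S \<noteq> {}" "S \<subseteq> V n"
  shows "{t *\<^sub>R partial_two_cut n S |t. 0 \<le> t} extreme_ray_of sPMET (V n)"
proof -
  let ?g = "partial_two_cut n S"
  let ?R = "{t *\<^sub>R ?g |t. 0 \<le> t}"
  obtain s where s: "s \<in> S" using S by blast
  \<comment> \<open>This is the face property for one endpoint: if an inner point of a segment in
    the cone is a multiple of the cut, the endpoint \<open>a\<close> lies on the ray.\<close>
  have multiple: "a \<in> ?R"
    if a: "a \<in> sPMET (V n)" and b: "b \<in> sPMET (V n)" and u: "0 < u" "u < 1"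
      and eq: "(1 - u) *\<^sub>R a + u *\<^sub>R b = t *\<^sub>R ?g" for a b u t
  proof -
    have eq': "(1 - u) * a i j + u * b i j = t * ?g i j" for i j
      using fun_cong[OF fun_cong[OF eq, of i], of j] by simp
    \<comment> \<open>An inequality that is tight at an inner point of the segment is tight at the
      endpoint; \<open>x\<close> and \<open>y\<close> stand for its slack at \<open>a\<close> and
      \<open>b\<close>.\<close>
    have tight: "x = 0" if "(1 - u) * x + u * y = 0" "0 \<le> x" "0 \<le> y" for x y
      using u that by (smt (verit) mult_nonneg_nonneg mult_pos_pos)
    have A: "a i j = a j i" "0 \<le> a i j" "a i i \<le> a i j" "a j j \<le> a i j" "a i j \<le> a i i + a j j"
      and B: "b i j = b j i" "0 \<le> b i j" "b i i \<le> b i j" "b j j \<le> b i j" "b i j \<le> b i i + b j j"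
      if "i \<in> V n" "j \<in> V n" for i j
      using a b that unfolding sPMET_iff by metis+
    \<comment> \<open>Tightness of \<open>0 \<le> p i j\<close> for two points outside
      \<open>S\<close>.\<close>
    have out: "a i j = 0" if "i \<in> V n" "j \<in> V n" "i \<notin> S" "j \<notin> S" for i j
      using tight[of "a i j" "b i j"] eq'[of i j] A[of i j] B[of i j] that
      by (simp add: partial_two_cut_def)
    \<comment> \<open>Tightness of \<open>p i i \<le> p i j\<close> for \<open>i\<close> in
      \<open>S\<close>.\<close>
    have row: "a i j = a i i" if "i \<in> V n" "j \<in> V n" "i \<in> S" for i j
    proof -
      have "?g i j = ?g i i" using that by (simp add: partial_two_cut_def)
      then have "(1 - u) * (a i j - a i i) + u * (b i j - b i i) = 0"
        using eq'[of i j] eq'[of i i] by (simp add: algebra_simps)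
      then show ?thesis
        using tight[of "a i j - a i i" "b i j - b i i"] A[of i j] B[of i j] that by simp
    qed
    \<comment> \<open>By \<open>row\<close> in both directions,
      \<open>a i i = a i s = a s i = a s s\<close>. So \<open>a\<close> has a single value on all
      entries that meet \<open>S\<close>.\<close>
    have "a i i = a s s" if "i \<in> S" for i
      using row[of i s] row[of s i] A(1)[of i s] that s S by (metis subsetD)
    then have mult: "a i j = a s s * ?g i j" for i j
    proof (cases "i \<in> V n \<and> j \<in> V n")
      case True
      then show ?thesis
        using out[of i j] row[of i j] row[of j i] A(1)[of i j] \<open>\<And>i. i \<in> S \<Longrightarrow> a i i = a s s\<close>
        by (auto simp: partial_two_cut_def)
    next
      case False
      then have "a i j = 0" using a unfolding sPMET_iff by blast
      then show ?thesis using False by (auto simp: partial_two_cut_def)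
    qed
    have "a = a s s *\<^sub>R ?g"
      by (intro ext) (simp only: scaleR_fun_apply real_scaleR_def, rule mult)
    moreover have "0 \<le> a s s" using A(2)[of s s] s S by blast
    ultimately show ?thesis by blast
  qed
  have "?R \<subseteq> sPMET (V n)"
  proof
    fix x assume "x \<in> ?R"
    then obtain t where x: "x = t *\<^sub>R ?g" "0 \<le> t" by blast
    then show "x \<in> sPMET (V n)"
      unfolding sPMET_iff partial_two_cut_def by auto
  qed
  moreover have "convex ?R"
  proof (rule convexI)
    fix x y and u v :: real assume "x \<in> ?R" "y \<in> ?R" and uv: "0 \<le> u" "0 \<le> v"
    then obtain r t where "x = r *\<^sub>R ?g" "y = t *\<^sub>R ?g" "0 \<le> r" "0 \<le> t" by blast
    then have "u *\<^sub>R x + v *\<^sub>R y = (u * r + v * t) *\<^sub>R ?g" "0 \<le> u * r + v * t"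
      using uv by (simp_all add: scaleR_add_left)
    then show "u *\<^sub>R x + v *\<^sub>R y \<in> ?R" by blast
  qed
  moreover have "a \<in> ?R \<and> b \<in> ?R"
    if ab: "a \<in> sPMET (V n)" "b \<in> sPMET (V n)" "x \<in> ?R" "x \<in> open_segment a b" for a b x
  proof -
    obtain t where t: "x = t *\<^sub>R ?g" using ab(3) by blast
    obtain u where u: "0 < u" "u < 1" "x = (1 - u) *\<^sub>R a + u *\<^sub>R b"
      using ab(4) by (auto simp: in_segment)
    \<comment> \<open>The same point with the endpoints exchanged, so that \<open>multiple\<close>
      also applies to \<open>b\<close>.\<close>
    have "(1 - (1 - u)) *\<^sub>R b + (1 - u) *\<^sub>R a = t *\<^sub>R ?g"
      using t u by (simp add: add.commute)
    then show ?thesis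
      using multiple[of a b u t] multiple[of b a "1 - u" t] ab(1,2) t u by simp
  qed
  ultimately have "?R face_of sPMET (V n)"
    unfolding face_of_def by blast
  then show ?thesis
    unfolding extreme_ray_of_def using S partial_two_cut_eq_0_iff by blast
qed

text \<open>Each partial 2-cut lies on the extreme ray it spans. Conversely, a nonzero 0,1-valued
  point on an extreme ray is a partial 2-cut by the classification, and it spans that ray.\<close>

lemma zero_one_cone_sPMET:
  "convex_cone hull {partial_two_cut n S |S. S \<noteq> {} \<and> S \<subseteq> V n} = zero_one_cone (sPMET (V n))"
  (is "convex_cone hull ?G = _")
proof -
  let ?U = "\<Union>{R. R extreme_ray_of sPMET (V n) \<and> (\<exists>p\<in>R. p \<noteq> 0 \<and> zero_one_valued p)}"
  have "?G \<subseteq> ?U"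
  proof
    fix p assume "p \<in> ?G"
    then obtain S where S: "S \<noteq> {}" "S \<subseteq> V n" and p: "p = partial_two_cut n S" by blast
    let ?R = "{t *\<^sub>R p |t. 0 \<le> t}"
    have "p \<in> ?R" by (rule CollectI, rule exI[of _ 1]) simp
    moreover have "p \<noteq> 0" "zero_one_valued p"
      using p S partial_two_cut_eq_0_iff zero_one_valued_partial_two_cut by auto
    ultimately show "p \<in> ?U"
      using partial_two_cut_extreme_ray[OF S, folded p] by blast
  qed
  then have "convex_cone hull ?G \<subseteq> convex_cone hull ?U"
    by (rule hull_mono)
  moreover have "?U \<subseteq> convex_cone hull ?G"
  proof
    fix x assume "x \<in> ?U"
    then obtain R p where R: "R extreme_ray_of sPMET (V n)" and x: "x \<in> R"
      and p: "p \<in> R" "p \<noteq> 0" "zero_one_valued p" by blast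
    obtain v where v: "R = {t *\<^sub>R v |t. 0 \<le> t}"
      using R unfolding extreme_ray_of_def by blast
    have "p \<in> sPMET (V n)"
      using R p face_of_imp_subset unfolding extreme_ray_of_def by blast
    then have G: "p \<in> ?G"
      using zero_one_valued_sPMET_eq[of n] p by blast
    obtain r t where rt: "p = r *\<^sub>R v" "0 \<le> r" "x = t *\<^sub>R v" "0 \<le> t"
      using x p v by blast
    \<comment> \<open>As \<open>p\<close> is nonzero it can replace \<open>v\<close> as the spanning
      vector of the ray, with coefficient \<open>t / r\<close>.\<close>
    then have "r \<noteq> 0" using p by auto
    then have "x = (t / r) *\<^sub>R p" using rt by simp
    moreover have "0 \<le> t / r" using rt by simp
    ultimately show "x \<in> convex_cone hull ?G"
      using convex_cone_hull_mul[OF hull_inc[OF G]] by (simp only:)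
  qed
  then have "convex_cone hull ?U \<subseteq> convex_cone hull ?G"
    by (simp add: hull_minimal convex_cone_convex_cone_hull)
  ultimately show ?thesis
    unfolding zero_one_cone_def by blast
qed

section \<open>Images of the cut cone under P and Q\<close>

lemma P_iota:
  "P n (iota n d) = (\<lambda>i j. if i \<in> V n \<and> j \<in> V n then (d i j + d 0 i + d 0 j) / 2 else 0)"
  by (auto simp: P_def iota_def fun_eq_iff)

lemma fst_Q_iota:
  "fst (Q n (iota n d)) = (\<lambda>i j. if i \<in> V n \<and> j \<in> V n then (d i j - d 0 i + d 0 j) / 2 else 0)"
  by (auto simp: Q_def iota_def fun_eq_iff)

lemma linear_P_iota: "linear (\<lambda>d. P n (iota n d))"
  by (rule linearI) (auto simp: P_iota fun_eq_iff field_simps)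

lemma linear_fst_Q_iota: "linear (\<lambda>d. fst (Q n (iota n d)))"
  by (rule linearI) (auto simp: fst_Q_iota fun_eq_iff field_simps)

text \<open>The set is the side of the cut that does not contain 0. Distances to 0 are its
  indicator, and half of \<open>d i j + d 0 i + d 0 j\<close> is then the maximum of the two
  indicator values.\<close>

lemma P_iota_two_cut:
  "P n (iota n (two_cut {0..n} T)) = partial_two_cut n (if 0 \<in> T then V n - T else V n \<inter> T)"
  by (auto simp: P_iota two_cut_def partial_two_cut_def fun_eq_iff)

text \<open>Here the set is the side containing 0: half of \<open>d i j - d 0 i + d 0 j\<close> is 1
  exactly when \<open>i\<close> is on the side of 0 and \<open>j\<close> is not.\<close>

lemma fst_Q_iota_two_cut:
  "fst (Q n (iota n (two_cut {0..n} T))) = o_cut n (if 0 \<in> T then V n \<inter> T else V n - T)"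
  by (auto simp: fst_Q_iota two_cut_def o_cut_def fun_eq_iff)

lemma P_iota_CUT:
  "P n ` iota n ` CUT {0..n} =
     convex_cone hull {partial_two_cut n S |S. S \<noteq> {} \<and> S \<subseteq> V n}"
  (is "_ = convex_cone hull ?G")
proof -
  let ?f = "\<lambda>d. P n (iota n d)"
  \<comment> \<open>Generators go to generators; the additional 0 comes from \<open>T = {}\<close>
    and \<open>T = {0..n}\<close>.\<close>
  have "?f ` {two_cut {0..n} T |T. T \<subseteq> {0..n}} = insert 0 ?G"
  proof (intro equalityI subsetI)
    fix p assume "p \<in> ?f ` {two_cut {0..n} T |T. T \<subseteq> {0..n}}"
    then obtain S where "S \<subseteq> V n" "p = partial_two_cut n S"
      using P_iota_two_cut[of n] by (smt (verit) Diff_subset Int_lower1 imageE mem_Collect_eq)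
    then show "p \<in> insert 0 ?G"
      using partial_two_cut_eq_0_iff by blast
  next
    fix p assume "p \<in> insert 0 ?G"
    then have "p = partial_two_cut n {} \<or> p \<in> ?G"
      using partial_two_cut_eq_0_iff[of "{}" n] by (simp only: insert_iff simp_thms empty_subsetI)
    then obtain S where S: "S \<subseteq> V n" and p: "p = partial_two_cut n S"
      by blast
    then have "0 \<notin> S" "V n \<inter> S = S" "S \<subseteq> {0..n}" by auto
    then have "p = ?f (two_cut {0..n} S)" "S \<subseteq> {0..n}"
      using p by (simp_all add: P_iota_two_cut)
    then show "p \<in> ?f ` {two_cut {0..n} T |T. T \<subseteq> {0..n}}" by blast
  qed
  then have "?f ` CUT {0..n} = convex_cone hull ?G"
    unfolding CUT_def convex_cone_hull_linear_image[OF linear_P_iota, symmetric]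
    by (simp add: convex_cone_hull_insert_0)
  then show ?thesis by (simp add: image_image)
qed

lemma Q_iota_CUT: "{q. \<exists>w. (q, w) \<in> Q n ` iota n ` CUT {0..n}} = OCUT n"
proof -
  let ?f = "\<lambda>d. fst (Q n (iota n d))"
  have "?f ` {two_cut {0..n} T |T. T \<subseteq> {0..n}} = {o_cut n S |S. S \<subseteq> V n}"
  proof (intro equalityI subsetI)
    fix q assume "q \<in> ?f ` {two_cut {0..n} T |T. T \<subseteq> {0..n}}"
    then show "q \<in> {o_cut n S |S. S \<subseteq> V n}"
      using fst_Q_iota_two_cut[of n] by (smt (verit) Diff_subset Int_lower1 imageE mem_Collect_eq)
  next
    fix q assume "q \<in> {o_cut n S |S. S \<subseteq> V n}"
    then obtain S where S: "S \<subseteq> V n" and q: "q = o_cut n S" by blast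
    \<comment> \<open>The point 0 is put on the side of \<open>S\<close>, so that the resulting
      o-cut leaves \<open>S\<close> and not its complement.\<close>
    then have "V n \<inter> insert 0 S = S" "insert 0 S \<subseteq> {0..n}" by auto
    then have "q = ?f (two_cut {0..n} (insert 0 S))" "insert 0 S \<subseteq> {0..n}"
      using q by (simp_all add: fst_Q_iota_two_cut)
    then show "q \<in> ?f ` {two_cut {0..n} T |T. T \<subseteq> {0..n}}" by blast
  qed
  then have "?f ` CUT {0..n} = OCUT n"
    unfolding CUT_def OCUT_def convex_cone_hull_linear_image[OF linear_fst_Q_iota, symmetric]
    by simp
  moreover have "{q. \<exists>w. (q, w) \<in> Q n ` iota n ` CUT {0..n}} = ?f ` CUT {0..n}"
    by (auto simp: image_image image_iff) (metis fst_conv, metis prod.collapse)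
  ultimately show ?thesis by simp
qed

theorem theorem2:
  fixes n :: nat
  assumes "n \<ge> 1"
  shows
    "sPMET (V n) = {p \<in> PMET (V n). lifting p \<in> PMET {0..n}} \<and>
     bij_betw (iota n) (MET {0..n}) (sWMET n) \<and>
     P n ` iota n ` MET {0..n} = sPMET (V n) \<and>
     {p \<in> sPMET (V n). zero_one_valued p} =
       insert 0 {partial_two_cut n S |S. S \<noteq> {} \<and> S \<subseteq> V n} \<and>
     card {partial_two_cut n S |S. S \<noteq> {} \<and> S \<subseteq> V n} = 2 ^ n - 1 \<and>
     convex_cone hull {partial_two_cut n S |S. S \<noteq> {} \<and> S \<subseteq> V n} =
       zero_one_cone (sPMET (V n)) \<and>
     zero_one_cone (sPMET (V n)) = P n ` iota n ` CUT {0..n} \<and>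
     {q. \<exists>w. (q, w) \<in> Q n ` iota n ` CUT {0..n}} = OCUT n"
proof (intro conjI)
  have "iota n ` MET {0..n} = sWMET n"
    using bij_betw_iota by (rule bij_betw_imp_surj_on)
  then show "P n ` iota n ` MET {0..n} = sPMET (V n)"
    by (simp only: P_image_sWMET)
  show "zero_one_cone (sPMET (V n)) = P n ` iota n ` CUT {0..n}"
    by (simp only: P_iota_CUT zero_one_cone_sPMET)
  have "{0..n} = insert 0 (V n)" by auto
  then show "sPMET (V n) = {p \<in> PMET (V n). lifting p \<in> PMET {0..n}}"
    using sPMET_eq_lifting[of "V n"] by simp
qed (rule bij_betw_iota zero_one_valued_sPMET_eq card_partial_two_cuts
    zero_one_cone_sPMET Q_iota_CUT)+

end
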